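(* Let $1\le p<\infty$ and let $T$ be a backward unilateral weighted shift on $\ell^p(\mathbb{N})$ with decreasing weight sequence $\{w_n\}_{n=1}^\infty$ of positive numbers (that is, $w_{n+1}\le w_n$ for all $n\ge 1$). If $\{w_n\}_{n=1}^\infty$ is $p'$-summable for some positive number $p'$ (that is, $\sum_{n=1}^\infty w_n^{p'}<\infty$), then $1\in\Lambda(T)$.
   Context: $\ell^p(\mathbb{N})$ is the complex Banach space of $p$-summable complex sequences indexed by $\mathbb{N}=\{0,1,2,\dots\}$, with canonical basis $\{e_n\}_{n=0}^\infty$. A backward unilateral weighted shift on $\ell^p(\mathbb{N})$ with weight sequence $\{w_n\}_{n=1}^\infty$ is a bounded linear operator $T$ with $Te_0=0$ and $Te_n=w_ne_{n-1}$ for all $n\ge 1$. A bounded operator $T$ on a complex Banach space $X$ is quasinilpotent if its spectrum is $\{0\}$ (the operator $T$ in the claim is quasinilpotent). For quasinilpotent $T$ and $x\in X\setminus\{0\}$, $$k_x=k_{(T,x)}=\limsup_{z\to 0}\frac{\ln\|(z-T)^{-1}x\|}{\ln\|(z-T)^{-1}\|}$$ ($z\in\mathbb{C}\setminus\{0\}$), and the power set of $T$ is $\Lambda(T)=\{k_x: x\in X\setminus\{0\}\}$. *)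

theory Defs
  imports "HOL-Analysis.Analysis"
begin

text \<open>
  Since \<open>p\<close> is a real parameter, \<open>\<ell>\<^sup>p(\<nat>)\<close> is not a type but a carrier set of complex sequences with
  an explicit norm; operators are functions on all sequences of which only the restriction to the
  carrier matters.
\<close>

definition lp :: "real \<Rightarrow> (nat \<Rightarrow> complex) set" where
  "lp p = {x. summable (\<lambda>n. cmod (x n) powr p)}"

definition lp_norm :: "real \<Rightarrow> (nat \<Rightarrow> complex) \<Rightarrow> real" where
  "lp_norm p x = (\<Sum>n. cmod (x n) powr p) powr (1 / p)"

definition lp_basis :: "nat \<Rightarrow> nat \<Rightarrow> complex" where
  "lp_basis n = (\<lambda>k. if k = n then 1 else 0)"

definition lp_bounded_linear ::
    "real \<Rightarrow> ((nat \<Rightarrow> complex) \<Rightarrow> nat \<Rightarrow> complex) \<Rightarrow> bool" where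
  "lp_bounded_linear p T \<longleftrightarrow>
     (\<forall>x\<in>lp p. T x \<in> lp p) \<and>
     (\<forall>x\<in>lp p. \<forall>y\<in>lp p. T (\<lambda>n. x n + y n) = (\<lambda>n. T x n + T y n)) \<and>
     (\<forall>c. \<forall>x\<in>lp p. T (\<lambda>n. c * x n) = (\<lambda>n. c * T x n)) \<and>
     (\<exists>K. \<forall>x\<in>lp p. lp_norm p (T x) \<le> K * lp_norm p x)"

definition lp_onorm :: "real \<Rightarrow> ((nat \<Rightarrow> complex) \<Rightarrow> nat \<Rightarrow> complex) \<Rightarrow> real" where
  "lp_onorm p T = (SUP x\<in>{x\<in>lp p. lp_norm p x \<le> 1}. lp_norm p (T x))"

definition scalar_minus ::
    "complex \<Rightarrow> ((nat \<Rightarrow> complex) \<Rightarrow> nat \<Rightarrow> complex) \<Rightarrow> (nat \<Rightarrow> complex) \<Rightarrow> nat \<Rightarrow> complex" where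
  "scalar_minus z T x = (\<lambda>n. z * x n - T x n)"

definition lp_spectrum ::
    "real \<Rightarrow> ((nat \<Rightarrow> complex) \<Rightarrow> nat \<Rightarrow> complex) \<Rightarrow> complex set" where
  "lp_spectrum p T = {z. \<not> (\<exists>S. lp_bounded_linear p S \<and>
      (\<forall>x\<in>lp p. S (scalar_minus z T x) = x \<and> scalar_minus z T (S x) = x))}"

text \<open>Equal on \<open>lp p\<close> to the bounded inverse of \<open>z - T\<close> whenever \<open>z \<notin> lp_spectrum p T\<close>.\<close>

definition lp_resolvent ::
    "real \<Rightarrow> ((nat \<Rightarrow> complex) \<Rightarrow> nat \<Rightarrow> complex) \<Rightarrow> complex \<Rightarrow> (nat \<Rightarrow> complex) \<Rightarrow> nat \<Rightarrow> complex" where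
  "lp_resolvent p T z = inv_into (lp p) (scalar_minus z T)"

definition lp_quasinilpotent ::
    "real \<Rightarrow> ((nat \<Rightarrow> complex) \<Rightarrow> nat \<Rightarrow> complex) \<Rightarrow> bool" where
  "lp_quasinilpotent p T \<longleftrightarrow> lp_bounded_linear p T \<and> lp_spectrum p T = {0}"

definition lp_power_index ::
    "real \<Rightarrow> ((nat \<Rightarrow> complex) \<Rightarrow> nat \<Rightarrow> complex) \<Rightarrow> (nat \<Rightarrow> complex) \<Rightarrow> ereal" where
  "lp_power_index p T x =
     Limsup (at 0) (\<lambda>z. ereal (ln (lp_norm p (lp_resolvent p T z x)) /
                               ln (lp_onorm p (lp_resolvent p T z))))"

text \<open>
  The power set is only defined for quasinilpotent operators. The guard gives every other operator
  the empty power set, so membership in it includes quasinilpotency.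
\<close>

definition lp_power_set ::
    "real \<Rightarrow> ((nat \<Rightarrow> complex) \<Rightarrow> nat \<Rightarrow> complex) \<Rightarrow> ereal set" where
  "lp_power_set p T =
     {lp_power_index p T x | x. lp_quasinilpotent p T \<and> x \<in> lp p \<and> x \<noteq> (\<lambda>_. 0)}"

text \<open>The weights are \<open>w 1, w 2, \<dots>\<close>; the value \<open>w 0\<close> is not used.\<close>

definition backward_weighted_shift ::
    "real \<Rightarrow> (nat \<Rightarrow> complex) \<Rightarrow> ((nat \<Rightarrow> complex) \<Rightarrow> nat \<Rightarrow> complex) \<Rightarrow> bool" where
  "backward_weighted_shift p w T \<longleftrightarrow>
     lp_bounded_linear p T \<and>
     T (lp_basis 0) = (\<lambda>_. 0) \<and>
     (\<forall>n\<ge>1. T (lp_basis n) = (\<lambda>k. w n * lp_basis (n - 1) k))"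

end

theory Submission
  imports Defs
begin

text \<open>
  Write \<open>W k = w 1 * \<dots> * w k\<close> and \<open>r = 1 / \<bar>z\<bar>\<close>. The resolvent is the Neumann series
  \<open>\<Sum>k. T\<^sup>k x / z ^ (k + 1)\<close>. As the weights decrease, \<open>T\<^sup>k\<close> has norm \<open>W k\<close>, so the norm of the
  resolvent is at most the majorant \<open>F r = (\<Sum>k. W k * r ^ (k + 1))\<close>; it is at least each single
  term of that series, as the images of the basis vectors show. Hence it grows faster than every
  power of \<open>r\<close>, and any factor that is polynomial in \<open>r\<close> disappears from the quotient of
  logarithms. For every nonzero vector the limit superior is at most \<open>1\<close>, because the norm of the
  vector is such a factor.

  The value \<open>1\<close> is attained at the vector with entries \<open>1 / (k + 1)\<^sup>2\<close>, already along
  \<open>z = 1 / r\<close> with \<open>r\<close> positive, where all terms of the Neumann series are positive. The coordinate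
  of its resolvent with index \<open>0\<close> is \<open>\<Sum>k. W k * r ^ (k + 1) / (k + 1)\<^sup>2\<close>. If \<open>w j \<le> 1 / (2 * r)\<close>
  for all \<open>j > N\<close>, the terms of the majorant at least halve from index \<open>N\<close> on, and therefore this
  coordinate is at least \<open>F r / (2 * (N + 1)\<^sup>2)\<close> (\<open>majorant_le_resolvent_quadratic_decay\<close>).
  Summability is what makes the loss harmless: for a decreasing sequence whose powers with exponent
  \<open>p'\<close> are summable one can take \<open>N = O(r powr p')\<close> (\<open>large_weights_count\<close>), which is polynomial
  in \<open>r\<close>.
\<close>

section \<open>Sequences in \<open>\<ell>\<^sup>p\<close>\<close>

lemma lp_norm_nonneg: "0 \<le> lp_norm p x"
  by (simp add: lp_norm_def)

lemma lp_norm_powr: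
  assumes "1 \<le> p" "x \<in> lp p"
  shows "lp_norm p x powr p = (\<Sum>n. cmod (x n) powr p)"
proof -
  have "0 \<le> (\<Sum>n. cmod (x n) powr p)"
    using assms by (intro suminf_nonneg) (auto simp: lp_def)
  then show ?thesis
    using assms by (simp add: lp_norm_def powr_powr)
qed

lemma norm_component_le_lp_norm:
  assumes "1 \<le> p" "x \<in> lp p"
  shows "cmod (x n) \<le> lp_norm p x"
proof -
  have "cmod (x n) powr p \<le> lp_norm p x powr p"
    unfolding lp_norm_powr[OF assms]
    using sum_le_suminf[of "\<lambda>n. cmod (x n) powr p" "{n}"] assms by (auto simp: lp_def)
  then show ?thesis
    using assms by (meson less_le_trans lp_norm_nonneg not_le powr_less_mono2 zero_less_one)
qed

lemma lp_norm_pos: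
  assumes "1 \<le> p" "x \<in> lp p" "x \<noteq> (\<lambda>_. 0)"
  shows "0 < lp_norm p x"
proof -
  obtain n where "x n \<noteq> 0" using assms(3) by auto
  then show ?thesis
    using norm_component_le_lp_norm[OF assms(1,2), of n] by (smt (verit) zero_less_norm_iff)
qed

lemma lp_scale: "x \<in> lp p \<Longrightarrow> (\<lambda>n. c * x n) \<in> lp p"
  by (auto simp: lp_def norm_mult powr_mult intro: summable_mult)

lemma lp_norm_scale:
  assumes "1 \<le> p" "x \<in> lp p"
  shows "lp_norm p (\<lambda>n. c * x n) = cmod c * lp_norm p x"
proof -
  have "(\<Sum>n. cmod (c * x n) powr p) = cmod c powr p * (\<Sum>n. cmod (x n) powr p)"
    using assms by (simp add: norm_mult powr_mult suminf_mult lp_def)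
  moreover have "0 \<le> (\<Sum>n. cmod (x n) powr p)"
    using assms by (intro suminf_nonneg) (auto simp: lp_def)
  ultimately show ?thesis
    using assms by (simp add: lp_norm_def powr_mult powr_powr)
qed

lemma lp_finite_support:
  assumes "\<And>n. N \<le> n \<Longrightarrow> x n = 0"
  shows "x \<in> lp p"
  unfolding lp_def mem_Collect_eq
  by (rule summable_finite[of "{..<N}"]) (use assms in auto)

lemma lp_basis_in_lp: "lp_basis n \<in> lp p"
  by (rule lp_finite_support[of "Suc n"]) (auto simp: lp_basis_def)

lemma lp_norm_basis: "lp_norm p (lp_basis n) = 1"
proof -
  have "(\<lambda>k. cmod (lp_basis n k) powr p) = (\<lambda>k. if k = n then 1 else 0)"
    by (auto simp: lp_basis_def)
  then have "(\<Sum>k. cmod (lp_basis n k) powr p) = 1"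
    using sums_single[of n "\<lambda>_. 1::real"] by (simp add: sums_iff)
  then show ?thesis by (simp add: lp_norm_def)
qed

text \<open>
  Jensen's inequality for the convex function \<open>t powr p\<close> and the weights \<open>a\<close>, obtained by
  integrating the tangent line at the weighted mean \<open>m\<close>; the tangent line inequality itself is a
  rescaled weighted arithmetic-geometric mean inequality.
\<close>
lemma weighted_power_mean_suminf:
  fixes a u :: "nat \<Rightarrow> real"
  assumes p: "1 \<le> p" and a0: "\<And>k. 0 \<le> a k" and u0: "\<And>k. 0 \<le> u k"
    and sa: "summable a" and F: "0 < suminf a"
    and sau: "summable (\<lambda>k. a k * u k)" and saup: "summable (\<lambda>k. a k * u k powr p)"
  shows "(\<Sum>k. a k * u k) powr p \<le> suminf a powr (p - 1) * (\<Sum>k. a k * u k powr p)"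
proof -
  define m where "m = (\<Sum>k. a k * u k) / suminf a"
  have S: "(\<Sum>k. a k * u k) = suminf a * m" using F by (simp add: m_def)
  have m0: "0 \<le> m" unfolding m_def using F sau a0 u0 by (intro divide_nonneg_pos suminf_nonneg) auto
  have U0: "0 \<le> (\<Sum>k. a k * u k powr p)"
    using saup a0 by (intro suminf_nonneg) auto
  show ?thesis
  proof (cases "m = 0")
    case True
    then show ?thesis using U0 S by simp
  next
    case False
    with m0 have m: "0 < m" by simp
    have tangent: "p * m powr (p - 1) * u k \<le> u k powr p + (p - 1) * m powr p" for k
    proof -
      have "(u k powr p) powr (1/p) * (m powr p) powr (1 - 1/p)
          \<le> 1/p * (u k powr p) + (1 - 1/p) * m powr p"
      proof (cases "u k = 0")
        case False
        then show ?thesis using p m by (intro Youngs_inequality_0) auto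
      qed (use p in auto)
      moreover have "(u k powr p) powr (1/p) = u k" using p u0 by (simp add: powr_powr)
      moreover have "(m powr p) powr (1 - 1/p) = m powr (p - 1)"
        using p by (simp add: powr_powr right_diff_distrib)
      ultimately have "u k * m powr (p - 1) \<le> 1/p * (u k powr p) + (1 - 1/p) * m powr p"
        by simp
      then have "p * (u k * m powr (p - 1)) \<le> p * (1/p * (u k powr p) + (1 - 1/p) * m powr p)"
        using p by (intro mult_left_mono) auto
      also have "\<dots> = u k powr p + (p - 1) * m powr p"
        using p by (simp add: distrib_left right_diff_distrib left_diff_distrib)
      finally show ?thesis by (simp add: mult_ac)
    qed
    have "p * m powr (p - 1) * (\<Sum>k. a k * u k)
        = (\<Sum>k. (p * m powr (p - 1)) * (a k * u k))"
      by (rule suminf_mult[OF sau, symmetric])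
    also have "\<dots> \<le> (\<Sum>k. a k * u k powr p + ((p - 1) * m powr p) * a k)"
    proof (rule suminf_le)
      show "(p * m powr (p - 1)) * (a k * u k) \<le> a k * u k powr p + ((p - 1) * m powr p) * a k" for k
        using mult_left_mono[OF tangent[of k] a0[of k]] by (simp add: algebra_simps)
    qed (intro summable_mult sau saup sa summable_add)+
    also have "\<dots> = (\<Sum>k. a k * u k powr p) + ((p - 1) * m powr p) * suminf a"
      by (subst suminf_add[symmetric]) (auto intro: summable_mult saup sa simp: suminf_mult[OF sa])
    finally have upper: "p * m powr (p - 1) * (suminf a * m)
        \<le> (\<Sum>k. a k * u k powr p) + ((p - 1) * m powr p) * suminf a"
      by (simp add: S)
    have "m powr (p - 1) * m = m powr p"
      using m by (simp add: powr_diff)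
    then have "p * m powr (p - 1) * (suminf a * m) = p * m powr p * suminf a"
      by (metis mult.assoc mult.commute)
    with upper have "suminf a * m powr p \<le> (\<Sum>k. a k * u k powr p)"
      by (simp only: left_diff_distrib mult_1_left) (simp add: mult.commute)
    then have "suminf a powr (p - 1) * (suminf a * m powr p)
        \<le> suminf a powr (p - 1) * (\<Sum>k. a k * u k powr p)"
      by (intro mult_left_mono) auto
    moreover have "suminf a powr (p - 1) * (suminf a * m powr p) = (suminf a * m) powr p"
      using F m by (simp add: powr_mult powr_diff)
    ultimately show ?thesis by (simp add: S)
  qed
qed

text \<open>
  This plays the part of Minkowski's inequality: a sum of translates of \<open>x\<close> with coefficients \<open>a\<close> has norm
  at most \<open>suminf a\<close> times that of \<open>x\<close>, because Jensen's inequality bounds the power of each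
  component by an average of powers of components of \<open>x\<close>, and every translate of \<open>x\<close> has norm at
  most that of \<open>x\<close>.
\<close>
lemma lp_dominated_by_translates:
  fixes a :: "nat \<Rightarrow> real"
  assumes p: "1 \<le> p" and a0: "\<And>k. 0 \<le> a k" and sa: "summable a" and F: "0 < suminf a"
    and x: "x \<in> lp p" and y: "\<And>n. cmod (y n) \<le> (\<Sum>k. a k * cmod (x (n + k)))"
  shows "y \<in> lp p" "lp_norm p y \<le> suminf a * lp_norm p x"
proof -
  let ?X = "\<Sum>n. cmod (x n) powr p"
  have sx: "summable (\<lambda>n. cmod (x n) powr p)" using x by (simp add: lp_def)
  have X0: "0 \<le> ?X" using sx by (intro suminf_nonneg) auto
  have s1: "summable (\<lambda>k. a k * cmod (x (n + k)))" for n
    by (rule summable_comparison_test'[OF summable_mult2[OF sa, of "lp_norm p x"]])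
      (use a0 norm_component_le_lp_norm[OF p x] in \<open>auto intro!: mult_left_mono\<close>)
  have s2: "summable (\<lambda>k. a k * cmod (x (n + k)) powr p)" for n
    by (rule summable_comparison_test'[OF summable_mult2[OF sa, of "lp_norm p x powr p"]])
      (use a0 norm_component_le_lp_norm[OF p x] p in \<open>auto intro!: mult_left_mono powr_mono2\<close>)
  have pointwise: "cmod (y n) powr p
      \<le> suminf a powr (p - 1) * (\<Sum>k. a k * cmod (x (n + k)) powr p)" for n
    using powr_mono2[OF _ _ y[of n], of p]
      weighted_power_mean_suminf[OF p a0 _ sa F s1[of n] s2[of n]] p by simp
  have translate: "(\<Sum>n<N. cmod (x (n + k)) powr p) \<le> ?X" for N k
  proof -
    have "(\<Sum>n<N. cmod (x (n + k)) powr p) = (\<Sum>n\<in>(\<lambda>n. n + k) ` {..<N}. cmod (x n) powr p)"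
      by (subst sum.reindex) auto
    also have "\<dots> \<le> ?X" by (rule sum_le_suminf[OF sx]) auto
    finally show ?thesis .
  qed
  have partial: "(\<Sum>n<N. cmod (y n) powr p) \<le> suminf a powr p * ?X" for N
  proof -
    have "(\<Sum>n<N. cmod (y n) powr p)
        \<le> (\<Sum>n<N. suminf a powr (p - 1) * (\<Sum>k. a k * cmod (x (n + k)) powr p))"
      by (intro sum_mono pointwise)
    also have "\<dots> = suminf a powr (p - 1) * (\<Sum>k. \<Sum>n<N. a k * cmod (x (n + k)) powr p)"
      by (subst suminf_sum[OF s2]) (simp add: sum_distrib_left)
    also have "\<dots> \<le> suminf a powr (p - 1) * (\<Sum>k. a k * ?X)"
    proof (intro mult_left_mono suminf_le)
      show "(\<Sum>n<N. a k * cmod (x (n + k)) powr p) \<le> a k * ?X" for k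
        unfolding sum_distrib_left[symmetric] by (intro mult_left_mono translate a0)
    qed (auto intro: summable_sum s2 summable_mult2 sa)
    also have "\<dots> = suminf a powr p * ?X"
      using F by (simp add: suminf_mult2[OF sa, symmetric] powr_diff)
    finally show ?thesis .
  qed
  have sy: "summable (\<lambda>n. cmod (y n) powr p)"
    by (rule summableI_nonneg_bounded[OF _ partial]) auto
  then show "y \<in> lp p" by (simp add: lp_def)
  have "(\<Sum>n. cmod (y n) powr p) \<le> suminf a powr p * ?X"
    by (rule suminf_le_const[OF sy partial])
  then have "lp_norm p y \<le> (suminf a powr p * ?X) powr (1 / p)"
    unfolding lp_norm_def using p sy by (intro powr_mono2 suminf_nonneg) auto
  also have "\<dots> = suminf a * lp_norm p x"
    unfolding lp_norm_def using p F X0 by (simp add: powr_mult powr_powr)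
  finally show "lp_norm p y \<le> suminf a * lp_norm p x" .
qed

section \<open>Weighted shifts in coordinates\<close>

lemma lp_tail:
  assumes "x \<in> lp p"
  shows "(\<lambda>n. if n < N then 0 else x n) \<in> lp p"
  using assms unfolding lp_def
  by (auto intro: summable_comparison_test'[of "\<lambda>n. cmod (x n) powr p"])

lemma lp_norm_tail_tendsto_0:
  assumes p: "1 \<le> p" and x: "x \<in> lp p"
  shows "(\<lambda>N. lp_norm p (\<lambda>n. if n < N then 0 else x n)) \<longlonglongrightarrow> 0"
proof -
  let ?f = "\<lambda>n. cmod (x n) powr p"
  have sx: "summable ?f" using x by (simp add: lp_def)
  have eq: "(\<Sum>n. cmod (if n < N then 0 else x n) powr p) = suminf ?f - (\<Sum>n<N. ?f n)" for N
  proof -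
    have s: "summable (\<lambda>n. cmod (if n < N then 0 else x n) powr p)"
      using lp_tail[OF x] by (simp add: lp_def)
    have "(\<Sum>n. cmod (if n < N then 0 else x n) powr p) = (\<Sum>n. ?f (n + N))"
      by (subst suminf_split_initial_segment[OF s, of N]) simp
    also have "\<dots> = suminf ?f - (\<Sum>n<N. ?f n)"
      by (rule suminf_minus_initial_segment[OF sx])
    finally show ?thesis .
  qed
  have "(\<lambda>N. suminf ?f - (\<Sum>n<N. ?f n)) \<longlonglongrightarrow> suminf ?f - suminf ?f"
    by (intro tendsto_intros summable_LIMSEQ sx)
  moreover have "0 \<le> suminf ?f - (\<Sum>n<N. ?f n)" for N
    using sum_le_suminf[OF sx, of "{..<N}"] by simp
  ultimately have "(\<lambda>N. (suminf ?f - (\<Sum>n<N. ?f n)) powr (1 / p)) \<longlonglongrightarrow> 0 powr (1 / p)"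
    using p by (intro tendsto_powr2) auto
  then show ?thesis unfolding lp_norm_def eq by simp
qed

text \<open>
  The action on basis vectors determines the operator only through boundedness: the image of a
  truncation is computed by linearity, and the images of the tails tend to \<open>0\<close> in norm, hence in
  every coordinate.
\<close>
lemma backward_weighted_shift_apply:
  assumes p: "1 \<le> p" and T: "backward_weighted_shift p w T" and x: "x \<in> lp p"
  shows "T x n = w (n + 1) * x (n + 1)"
proof -
  have maps: "\<And>x. x \<in> lp p \<Longrightarrow> T x \<in> lp p"
    and add: "\<And>x y. x \<in> lp p \<Longrightarrow> y \<in> lp p \<Longrightarrow> T (\<lambda>n. x n + y n) = (\<lambda>n. T x n + T y n)"
    and scale: "\<And>c x. x \<in> lp p \<Longrightarrow> T (\<lambda>n. c * x n) = (\<lambda>n. c * T x n)"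
    and basis0: "T (lp_basis 0) = (\<lambda>_. 0)"
    and basis: "\<And>n. n \<ge> 1 \<Longrightarrow> T (lp_basis n) = (\<lambda>k. w n * lp_basis (n - 1) k)"
    using T by (auto simp: backward_weighted_shift_def lp_bounded_linear_def)
  obtain K where K: "\<And>x. x \<in> lp p \<Longrightarrow> lp_norm p (T x) \<le> K * lp_norm p x"
    using T unfolding backward_weighted_shift_def lp_bounded_linear_def by blast
  define head where "head N = (\<lambda>n. if n < N then x n else 0)" for N
  define tail where "tail N = (\<lambda>n. if n < N then 0 else x n)" for N
  have head_lp: "head N \<in> lp p" for N
    by (rule lp_finite_support[of N]) (auto simp: head_def)
  have tail_lp: "tail N \<in> lp p" for N
    unfolding tail_def by (rule lp_tail[OF x])
  have zero: "T (\<lambda>_. 0) = (\<lambda>_. 0)"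
    using scale[OF x, of 0] by simp
  have T_head: "T (head N) n = (if n + 1 < N then w (n + 1) * x (n + 1) else 0)" for N n
  proof (induction N)
    case 0
    then show ?case using zero by (simp add: head_def)
  next
    case (Suc N)
    have "head (Suc N) = (\<lambda>n. head N n + x N * lp_basis N n)"
      by (auto simp: head_def lp_basis_def fun_eq_iff less_Suc_eq)
    then have "T (head (Suc N)) = (\<lambda>n. T (head N) n + x N * T (lp_basis N) n)"
      using add[OF head_lp lp_scale[OF lp_basis_in_lp]] scale[OF lp_basis_in_lp] by simp
    then show ?case
      using Suc basis0 basis[of N] by (cases "N = 0") (auto simp: lp_basis_def)
  qed
  have diff: "T x n - w (n + 1) * x (n + 1) = T (tail N) n" if "n + 1 < N" for N
  proof -
    have "x = (\<lambda>n. head N n + tail N n)" by (auto simp: head_def tail_def)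
    then have "T x = (\<lambda>n. T (head N) n + T (tail N) n)"
      using add[OF head_lp tail_lp, of N N] by simp
    then show ?thesis using that by (simp add: T_head)
  qed
  have tail_le: "cmod (T (tail N) n) \<le> K * lp_norm p (tail N)" for N
    using norm_component_le_lp_norm[OF p maps[OF tail_lp]] K[OF tail_lp] by (rule order_trans)
  have bound: "\<forall>\<^sub>F N in sequentially. cmod (T x n - w (n + 1) * x (n + 1)) \<le> K * lp_norm p (tail N)"
  proof (rule eventually_sequentiallyI[of "n + 2"])
    fix N assume "n + 2 \<le> N"
    then show "cmod (T x n - w (n + 1) * x (n + 1)) \<le> K * lp_norm p (tail N)"
      using tail_le[of N] by (subst diff[of N]) auto
  qed
  have "(\<lambda>N. K * lp_norm p (tail N)) \<longlonglongrightarrow> K * 0"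
    unfolding tail_def by (intro tendsto_intros lp_norm_tail_tendsto_0 p x)
  then have "cmod (T x n - w (n + 1) * x (n + 1)) \<le> 0"
    using tendsto_lowerbound[OF _ bound, of "K * 0"] by simp
  then show ?thesis by simp
qed

section \<open>The resolvent as a Neumann series\<close>

definition weight_product :: "(nat \<Rightarrow> real) \<Rightarrow> nat \<Rightarrow> nat \<Rightarrow> real" where
  "weight_product w n k = (\<Prod>j<k. w (n + j + 1))"

lemma weight_product_0 [simp]: "weight_product w n 0 = 1"
  by (simp add: weight_product_def)

lemma weight_product_Suc: "weight_product w n (Suc k) = weight_product w n k * w (n + k + 1)"
  by (simp add: weight_product_def)

lemma weight_product_Suc_left: "weight_product w n (Suc k) = w (n + 1) * weight_product w (n + 1) k"
  unfolding weight_product_def by (subst prod.lessThan_Suc_shift) simp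

definition neumann_series :: "(nat \<Rightarrow> real) \<Rightarrow> complex \<Rightarrow> (nat \<Rightarrow> complex) \<Rightarrow> nat \<Rightarrow> complex" where
  "neumann_series w z x n = (\<Sum>k. of_real (weight_product w n k) * x (n + k) / z ^ (k + 1))"

text \<open>
  As \<open>weight_product w 0 k\<close> is the norm of \<open>T\<^sup>k\<close> for decreasing \<open>w\<close>, this is the sum of the norms of
  the terms of the Neumann series at \<open>\<bar>z\<bar> = 1 / r\<close>.
\<close>
definition resolvent_majorant :: "(nat \<Rightarrow> real) \<Rightarrow> real \<Rightarrow> real" where
  "resolvent_majorant w r = (\<Sum>k. weight_product w 0 k * r ^ (k + 1))"

locale decreasing_backward_shift =
  fixes p :: real and w :: "nat \<Rightarrow> real" and T :: "(nat \<Rightarrow> complex) \<Rightarrow> nat \<Rightarrow> complex"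
  assumes p: "1 \<le> p"
    and shift: "backward_weighted_shift p (\<lambda>n. complex_of_real (w n)) T"
    and w_pos: "\<And>n. 1 \<le> n \<Longrightarrow> 0 < w n"
    and w_dec: "\<And>n. 1 \<le> n \<Longrightarrow> w (n + 1) \<le> w n"
    and w_null: "w \<longlonglongrightarrow> 0"
begin

lemma w_antimono: "1 \<le> m \<Longrightarrow> m \<le> n \<Longrightarrow> w n \<le> w m"
proof (rotate_tac, induction n rule: dec_induct)
  case (step n)
  then show ?case using w_dec[of n] by simp
qed simp

lemma weight_product_pos: "0 < weight_product w n k"
  unfolding weight_product_def by (intro prod_pos) (auto intro: w_pos)

lemma weight_product_le: "weight_product w n k \<le> weight_product w 0 k"
  unfolding weight_product_def
  by (intro prod_mono conjI w_antimono less_imp_le[OF w_pos]) auto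

lemma majorant_summable:
  assumes "0 \<le> r"
  shows "summable (\<lambda>k. weight_product w 0 k * r ^ (k + 1))"
proof -
  have "(\<lambda>n. r * w n) \<longlonglongrightarrow> r * 0" by (intro tendsto_intros w_null)
  then have "\<forall>\<^sub>F n in sequentially. r * w n < 1 / 2"
    by (rule order_tendstoD) simp
  then obtain N where N: "\<And>n. N \<le> n \<Longrightarrow> r * w n < 1 / 2"
    by (auto simp: eventually_sequentially)
  show ?thesis
  proof (rule summable_ratio_test[of "1 / 2" N])
    fix k assume "N \<le> k"
    then have "r * w (k + 1) * (weight_product w 0 k * r ^ (k + 1))
        \<le> 1 / 2 * (weight_product w 0 k * r ^ (k + 1))"
      using assms less_imp_le[OF N[of "k + 1"]] weight_product_pos[of 0 k]
      by (intro mult_right_mono) auto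
    then show "norm (weight_product w 0 (Suc k) * r ^ (Suc k + 1))
        \<le> 1 / 2 * norm (weight_product w 0 k * r ^ (k + 1))"
      using assms less_imp_le[OF weight_product_pos[of 0 k]] less_imp_le[OF w_pos[of "k + 1"]]
      by (simp add: weight_product_Suc abs_mult mult_ac)
  qed simp
qed

lemma majorant_ge:
  assumes "0 \<le> r"
  shows "weight_product w 0 k * r ^ (k + 1) \<le> resolvent_majorant w r"
  unfolding resolvent_majorant_def
  using sum_le_suminf[OF majorant_summable[OF assms], of "{k}"] assms
    less_imp_le[OF weight_product_pos] by auto

lemma majorant_pos: "0 < r \<Longrightarrow> 0 < resolvent_majorant w r"
  using majorant_ge[of r 0] by simp

lemma neumann_term_le:
  "cmod (of_real (weight_product w n k) * x (n + k) / z ^ (k + 1))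
    \<le> weight_product w 0 k * inverse (cmod z) ^ (k + 1) * cmod (x (n + k))"
proof -
  have "cmod (of_real (weight_product w n k) * x (n + k) / z ^ (k + 1))
      = weight_product w n k * (inverse (cmod z) ^ (k + 1) * cmod (x (n + k)))"
    using less_imp_le[OF weight_product_pos[of n k]]
    by (simp add: norm_mult norm_divide norm_power divide_inverse power_inverse norm_inverse mult_ac)
  also have "\<dots> \<le> weight_product w 0 k * (inverse (cmod z) ^ (k + 1) * cmod (x (n + k)))"
    by (intro mult_right_mono weight_product_le) auto
  finally show ?thesis by (simp add: mult_ac)
qed

context
  fixes z :: complex and x :: "nat \<Rightarrow> complex"
  assumes z: "z \<noteq> 0" and x: "x \<in> lp p"
begin

lemma summable_majorant_component:
  "summable (\<lambda>k. weight_product w 0 k * inverse (cmod z) ^ (k + 1) * cmod (x (n + k)))"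
proof (rule summable_comparison_test'[OF summable_mult2[OF majorant_summable]])
  show "norm (weight_product w 0 k * inverse (cmod z) ^ (k + 1) * cmod (x (n + k)))
    \<le> weight_product w 0 k * inverse (cmod z) ^ (k + 1) * lp_norm p x" for k
    using norm_component_le_lp_norm[OF p x, of "n + k"] less_imp_le[OF weight_product_pos[of 0 k]]
    by (simp add: abs_mult mult_left_mono)
qed auto

lemma summable_norm_neumann_term:
  "summable (\<lambda>k. cmod (of_real (weight_product w n k) * x (n + k) / z ^ (k + 1)))"
  by (rule summable_comparison_test'[OF summable_majorant_component[of n]])
    (use neumann_term_le in auto)

lemma summable_neumann_term:
  "summable (\<lambda>k. of_real (weight_product w n k) * x (n + k) / z ^ (k + 1))"
  by (rule summable_norm_cancel[OF summable_norm_neumann_term])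

lemma neumann_series_bound:
  shows neumann_series_in_lp: "neumann_series w z x \<in> lp p"
    and neumann_series_norm_le:
      "lp_norm p (neumann_series w z x) \<le> resolvent_majorant w (inverse (cmod z)) * lp_norm p x"
proof -
  have le: "cmod (neumann_series w z x n)
      \<le> (\<Sum>k. weight_product w 0 k * inverse (cmod z) ^ (k + 1) * cmod (x (n + k)))" for n
    unfolding neumann_series_def
    by (rule order_trans[OF summable_norm[OF summable_norm_neumann_term] suminf_le])
      (rule neumann_term_le summable_norm_neumann_term summable_majorant_component)+
  have a0: "0 \<le> weight_product w 0 k * inverse (cmod z) ^ (k + 1)" for k
    using less_imp_le[OF weight_product_pos[of 0 k]] by simp
  have F: "0 < (\<Sum>k. weight_product w 0 k * inverse (cmod z) ^ (k + 1))"
    using majorant_pos[of "inverse (cmod z)"] z by (simp add: resolvent_majorant_def)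
  note L = lp_dominated_by_translates[OF p a0 majorant_summable F x le]
  show "neumann_series w z x \<in> lp p" by (rule L) simp
  show "lp_norm p (neumann_series w z x) \<le> resolvent_majorant w (inverse (cmod z)) * lp_norm p x"
    unfolding resolvent_majorant_def by (rule L) simp
qed

text \<open>Splitting off the first term of the series at \<open>n\<close> leaves a multiple of the series at \<open>n + 1\<close>.\<close>
lemma neumann_series_right_inverse: "scalar_minus z T (neumann_series w z x) = x"
proof
  fix n
  let ?t = "\<lambda>n k. of_real (weight_product w n k) * x (n + k) / z ^ (k + 1)"
  have "(\<Sum>k. ?t n (Suc k)) = (\<Sum>k. (of_real (w (n + 1)) / z) * ?t (n + 1) k)"
    by (rule suminf_cong) (simp add: weight_product_Suc_left)
  also have "\<dots> = of_real (w (n + 1)) / z * neumann_series w z x (n + 1)"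
    unfolding neumann_series_def by (rule suminf_mult[OF summable_neumann_term])
  finally have "neumann_series w z x n
      = x n / z + of_real (w (n + 1)) / z * neumann_series w z x (n + 1)"
    using suminf_split_head[OF summable_neumann_term[of n]]
    by (simp add: neumann_series_def)
  then show "scalar_minus z T (neumann_series w z x) n = x n"
    using z backward_weighted_shift_apply[OF p shift neumann_series_in_lp, of n]
    by (simp add: scalar_minus_def field_simps)
qed

text \<open>Here the series telescopes, and the limit of the boundary term is \<open>0\<close> by summability.\<close>
lemma neumann_series_left_inverse: "neumann_series w z (scalar_minus z T x) = x"
proof
  fix n
  define c where "c k = of_real (weight_product w n k) * x (n + k) / z ^ k" for k
  have "(\<lambda>k. z * (of_real (weight_product w n k) * x (n + k) / z ^ (k + 1))) \<longlonglongrightarrow> z * 0"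
    by (intro tendsto_intros summable_LIMSEQ_zero summable_neumann_term)
  moreover have "(\<lambda>k. z * (of_real (weight_product w n k) * x (n + k) / z ^ (k + 1))) = c"
    using z by (simp add: c_def fun_eq_iff)
  ultimately have "c \<longlonglongrightarrow> 0" by simp
  then have "(\<lambda>k. c k - c (Suc k)) sums (c 0 - 0)" by (rule telescope_sums')
  moreover have "c k - c (Suc k)
      = of_real (weight_product w n k) * scalar_minus z T x (n + k) / z ^ (k + 1)" for k
    using z backward_weighted_shift_apply[OF p shift x, of "n + k"]
    by (simp add: c_def scalar_minus_def weight_product_Suc field_simps)
  ultimately show "neumann_series w z (scalar_minus z T x) n = x n"
    by (simp add: sums_iff neumann_series_def c_def)
qed

end

lemma neumann_series_bounded_linear:
  assumes z: "z \<noteq> 0"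
  shows "lp_bounded_linear p (neumann_series w z)"
  unfolding lp_bounded_linear_def
proof (intro conjI ballI allI exI)
  fix x y c assume x: "x \<in> lp p" and y: "y \<in> lp p"
  show "neumann_series w z (\<lambda>n. x n + y n) = (\<lambda>n. neumann_series w z x n + neumann_series w z y n)"
    unfolding neumann_series_def
    by (subst suminf_add[OF summable_neumann_term[OF z x] summable_neumann_term[OF z y]])
      (simp add: algebra_simps add_divide_distrib)
next
  fix c x assume x: "x \<in> lp p"
  show "neumann_series w z (\<lambda>n. c * x n) = (\<lambda>n. c * neumann_series w z x n)"
    unfolding neumann_series_def
    by (subst suminf_mult[OF summable_neumann_term[OF z x], symmetric]) (simp add: mult_ac)
qed (rule neumann_series_in_lp[OF z] neumann_series_norm_le[OF z], assumption)+

text \<open>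
  Away from \<open>0\<close> the Neumann series converges to a bounded inverse; \<open>0\<close> is in the spectrum because
  \<open>T\<close> annihilates \<open>lp_basis 0\<close>.
\<close>
lemma quasinilpotent: "lp_quasinilpotent p T"
proof -
  have "z \<notin> lp_spectrum p T" if "z \<noteq> 0" for z
    unfolding lp_spectrum_def
    using neumann_series_bounded_linear neumann_series_left_inverse neumann_series_right_inverse that
    by blast
  moreover have "0 \<in> lp_spectrum p T"
  proof -
    have "False" if S: "lp_bounded_linear p S"
      and inv: "\<forall>x\<in>lp p. S (scalar_minus 0 T x) = x" for S
    proof -
      have lin: "S (\<lambda>n. c * x n) = (\<lambda>n. c * S x n)" if "x \<in> lp p" for c x
        using S that by (auto simp: lp_bounded_linear_def)
      have "S (\<lambda>_. 0) = (\<lambda>_. 0)"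
        using lin[OF lp_basis_in_lp, of 0 0] by simp
      moreover have "scalar_minus 0 T (lp_basis 0) = (\<lambda>_. 0)"
        using shift by (simp add: backward_weighted_shift_def scalar_minus_def)
      then have "S (\<lambda>_. 0) = lp_basis 0"
        using bspec[OF inv lp_basis_in_lp, of 0] by simp
      ultimately have "lp_basis 0 0 = 0" by metis
      then show False by (simp add: lp_basis_def)
    qed
    then show ?thesis unfolding lp_spectrum_def by blast
  qed
  moreover have "lp_bounded_linear p T" using shift by (simp add: backward_weighted_shift_def)
  ultimately show ?thesis unfolding lp_quasinilpotent_def by blast
qed

lemma resolvent_eq_neumann_series:
  assumes z: "z \<noteq> 0" and x: "x \<in> lp p"
  shows "lp_resolvent p T z x = neumann_series w z x"
proof -
  have "inj_on (scalar_minus z T) (lp p)"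
    by (rule inj_on_inverseI[of _ "neumann_series w z"]) (rule neumann_series_left_inverse[OF z])
  then show ?thesis
    unfolding lp_resolvent_def
    using neumann_series_in_lp[OF z x] neumann_series_right_inverse[OF z x] inv_into_f_f by metis
qed

section \<open>The norm of the resolvent\<close>

lemma resolvent_norm_le_majorant_on_unit_ball:
  assumes z: "z \<noteq> 0" and x: "x \<in> lp p" "lp_norm p x \<le> 1"
  shows "lp_norm p (lp_resolvent p T z x) \<le> resolvent_majorant w (inverse (cmod z))"
  using neumann_series_norm_le[OF z x(1)] resolvent_eq_neumann_series[OF z x(1)]
    mult_left_le[OF x(2), of "resolvent_majorant w (inverse (cmod z))"]
    less_imp_le[OF majorant_pos[of "inverse (cmod z)"]] z by simp

lemma resolvent_norm_bdd_above:
  assumes "z \<noteq> 0"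
  shows "bdd_above ((\<lambda>x. lp_norm p (lp_resolvent p T z x)) ` {x \<in> lp p. lp_norm p x \<le> 1})"
  using resolvent_norm_le_majorant_on_unit_ball[OF assms] by (intro bdd_aboveI2) auto

lemma resolvent_onorm_le_majorant:
  assumes "z \<noteq> 0"
  shows "lp_onorm p (lp_resolvent p T z) \<le> resolvent_majorant w (inverse (cmod z))"
  unfolding lp_onorm_def
proof (rule cSUP_least)
  show "{x \<in> lp p. lp_norm p x \<le> 1} \<noteq> {}"
    using lp_basis_in_lp[of 0 p] lp_norm_basis[of p 0] by force
qed (use resolvent_norm_le_majorant_on_unit_ball[OF assms] in auto)

lemma resolvent_norm_le_onorm:
  assumes z: "z \<noteq> 0" and x: "x \<in> lp p" "x \<noteq> (\<lambda>_. 0)"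
  shows "lp_norm p (lp_resolvent p T z x) \<le> lp_onorm p (lp_resolvent p T z) * lp_norm p x"
proof -
  let ?c = "lp_norm p x"
  have c: "0 < ?c" by (rule lp_norm_pos[OF p x])
  define y where "y = (\<lambda>n. complex_of_real (inverse ?c) * x n)"
  have y: "y \<in> lp p" unfolding y_def by (rule lp_scale[OF x(1)])
  have "lp_norm p y = 1"
    unfolding y_def lp_norm_scale[OF p x(1)] using c by (simp add: norm_inverse)
  then have "lp_norm p (lp_resolvent p T z y) \<le> lp_onorm p (lp_resolvent p T z)"
    unfolding lp_onorm_def using y by (intro cSUP_upper resolvent_norm_bdd_above z) auto
  moreover have "neumann_series w z y = (\<lambda>n. complex_of_real (inverse ?c) * neumann_series w z x n)"
    using neumann_series_bounded_linear[OF z] x(1) unfolding y_def lp_bounded_linear_def by blast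
  then have "lp_norm p (lp_resolvent p T z y) = inverse ?c * lp_norm p (lp_resolvent p T z x)"
    using resolvent_eq_neumann_series[OF z] x(1) y c
      lp_norm_scale[OF p neumann_series_in_lp[OF z x(1)], of "complex_of_real (inverse ?c)"]
    by (simp add: norm_inverse)
  ultimately show ?thesis using c by (simp add: field_simps)
qed

text \<open>The coordinate with index \<open>0\<close> of the image of \<open>e\<^sub>n\<close> is a single term of the Neumann series.\<close>
lemma resolvent_onorm_ge:
  assumes z: "z \<noteq> 0"
  shows "weight_product w 0 n * inverse (cmod z) ^ (n + 1) \<le> lp_onorm p (lp_resolvent p T z)"
proof -
  have "(\<lambda>k. of_real (weight_product w 0 k) * lp_basis n (0 + k) / z ^ (k + 1))
      = (\<lambda>k. if k = n then of_real (weight_product w 0 n) / z ^ (n + 1) else 0)"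
    by (auto simp: lp_basis_def)
  then have "neumann_series w z (lp_basis n) 0 = of_real (weight_product w 0 n) / z ^ (n + 1)"
    unfolding neumann_series_def
    using sums_single[of n "\<lambda>_. of_real (weight_product w 0 n) / z ^ (n + 1)"]
    by (simp add: sums_iff)
  then have "weight_product w 0 n * inverse (cmod z) ^ (n + 1) = cmod (neumann_series w z (lp_basis n) 0)"
    using weight_product_pos[of 0 n]
    by (simp add: norm_divide norm_mult norm_power divide_inverse power_inverse norm_inverse)
  also have "\<dots> \<le> lp_norm p (lp_resolvent p T z (lp_basis n))"
    unfolding resolvent_eq_neumann_series[OF z lp_basis_in_lp]
    by (intro norm_component_le_lp_norm p neumann_series_in_lp z lp_basis_in_lp)
  also have "\<dots> \<le> lp_onorm p (lp_resolvent p T z)"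
    using resolvent_norm_le_onorm[OF z lp_basis_in_lp[of n p]] lp_norm_basis[of p n]
    by (force simp: lp_basis_def fun_eq_iff)
  finally show ?thesis .
qed

lemma resolvent_onorm_pos: "z \<noteq> 0 \<Longrightarrow> 0 < lp_onorm p (lp_resolvent p T z)"
  using resolvent_onorm_ge[of z 0] by (simp add: less_le_trans[of 0 "inverse (cmod z)"])

lemma ln_resolvent_onorm_at_top: "filterlim (\<lambda>z. ln (lp_onorm p (lp_resolvent p T z))) at_top (at 0)"
proof (rule filterlim_at_top_mono)
  have "filterlim (\<lambda>z::complex. cmod z) (at_right 0) (at 0)"
    unfolding filterlim_at
    by (auto simp: eventually_at_filter intro!: tendsto_eq_intros)
  then have "filterlim (\<lambda>z::complex. ln (inverse (cmod z))) at_top (at 0)"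
    by (intro filterlim_compose[OF ln_at_top] filterlim_compose[OF filterlim_inverse_at_top_right])
  then show "filterlim (\<lambda>z::complex. ln (inverse (cmod z))) at_top (at 0)" .
  show "\<forall>\<^sub>F z in at 0. ln (inverse (cmod z)) \<le> ln (lp_onorm p (lp_resolvent p T z))"
  proof (rule eventually_mono[OF eventually_neq_at_within[of 0]])
    fix z :: complex assume "z \<noteq> 0"
    then show "ln (inverse (cmod z)) \<le> ln (lp_onorm p (lp_resolvent p T z))"
      using resolvent_onorm_ge[of z 0] by (intro ln_mono) auto
  qed
qed

text \<open>
  Every term \<open>weight_product w 0 n * r ^ (n + 1)\<close> is a lower bound, so the norm outgrows each power
  of \<open>r\<close>.
\<close>
lemma resolvent_onorm_superpolynomial:
  "((\<lambda>r. ln r / ln (lp_onorm p (lp_resolvent p T (of_real (inverse r))))) \<longlongrightarrow> 0) at_top"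
proof -
  let ?L = "\<lambda>r. ln (lp_onorm p (lp_resolvent p T (of_real (inverse r))))"
  have "filterlim (\<lambda>r. ?L r / ln r) at_top at_top"
    unfolding filterlim_at_top
  proof
    fix Z :: real
    \<comment> \<open>The term of index \<open>n\<close> grows like \<open>r ^ (n + 1)\<close>; the spare exponent absorbs its constant.\<close>
    obtain n where n: "Z < real n" using reals_Archimedean2 by blast
    have "((\<lambda>r. ln (weight_product w 0 n) / ln r) \<longlongrightarrow> 0) at_top"
      by (intro real_tendsto_divide_at_top[OF tendsto_const] ln_at_top)
    then have "\<forall>\<^sub>F r in at_top. - 1 < ln (weight_product w 0 n) / ln r"
      by (rule order_tendstoD) simp
    then show "\<forall>\<^sub>F r in at_top. Z \<le> ?L r / ln r"
      using eventually_gt_at_top[of 1]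
    proof eventually_elim
      case (elim r)
      have "weight_product w 0 n * r ^ (n + 1) \<le> lp_onorm p (lp_resolvent p T (of_real (inverse r)))"
        using resolvent_onorm_ge[of "of_real (inverse r)" n] elim by (simp add: norm_inverse)
      then have "ln (weight_product w 0 n * r ^ (n + 1)) \<le> ?L r"
        using elim weight_product_pos[of 0 n] by (intro ln_mono) auto
      then have "ln (weight_product w 0 n) + real (n + 1) * ln r \<le> ?L r"
        using elim weight_product_pos[of 0 n] by (simp add: ln_mult ln_realpow distrib_right)
      then have "(ln (weight_product w 0 n) + real (n + 1) * ln r) / ln r \<le> ?L r / ln r"
        using elim by (intro divide_right_mono) auto
      moreover have "(ln (weight_product w 0 n) + real (n + 1) * ln r) / ln r
          = ln (weight_product w 0 n) / ln r + real (n + 1)"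
        using elim by (simp add: field_simps)
      ultimately show ?case using elim n by simp
    qed
  qed
  from tendsto_inverse_0_at_top[OF this] show ?thesis by simp
qed

text \<open>
  The numerator exceeds the denominator by at most the constant \<open>ln (lp_norm p x)\<close>, and the
  denominator tends to infinity.
\<close>
lemma power_index_le_1:
  assumes x: "x \<in> lp p" "x \<noteq> (\<lambda>_. 0)"
  shows "lp_power_index p T x \<le> 1"
proof -
  let ?L = "\<lambda>z. ln (lp_onorm p (lp_resolvent p T z))"
  have "((\<lambda>z. 1 + ln (lp_norm p x) / ?L z) \<longlongrightarrow> 1 + 0) (at 0)"
    by (intro tendsto_intros real_tendsto_divide_at_top[OF tendsto_const] ln_resolvent_onorm_at_top)
  then have lim: "((\<lambda>z. ereal (1 + ln (lp_norm p x) / ?L z)) \<longlongrightarrow> 1) (at 0)"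
    by (simp add: one_ereal_def)
  have "\<forall>\<^sub>F z in at 0. 0 < ?L z"
    using ln_resolvent_onorm_at_top by (simp add: filterlim_at_top_dense)
  then have "\<forall>\<^sub>F z in at 0. ereal (ln (lp_norm p (lp_resolvent p T z x)) / ?L z)
      \<le> ereal (1 + ln (lp_norm p x) / ?L z)"
    using eventually_neq_at_within[of 0]
  proof eventually_elim
    case (elim z)
    let ?y = "neumann_series w z x"
    have "scalar_minus z T ?y = x" using elim(2) x(1) by (rule neumann_series_right_inverse)
    moreover have "T (\<lambda>_. 0) = (\<lambda>_. 0)"
      using backward_weighted_shift_apply[OF p shift, of "\<lambda>_. 0"] by (auto simp: lp_def)
    ultimately have "?y \<noteq> (\<lambda>_. 0)" using x(2) by (auto simp: scalar_minus_def)
    then have "0 < lp_norm p (lp_resolvent p T z x)"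
      using elim(2) x(1) p by (simp add: resolvent_eq_neumann_series lp_norm_pos neumann_series_in_lp)
    then have "ln (lp_norm p (lp_resolvent p T z x))
        \<le> ln (lp_onorm p (lp_resolvent p T z) * lp_norm p x)"
      using resolvent_norm_le_onorm[OF elim(2) x] by (intro ln_mono) auto
    also have "\<dots> = ?L z + ln (lp_norm p x)"
      using resolvent_onorm_pos[OF elim(2)] lp_norm_pos[OF p x] by (simp add: ln_mult)
    finally show ?case using elim(1) by (simp add: field_simps)
  qed
  then have "lp_power_index p T x \<le> Limsup (at 0) (\<lambda>z. ereal (1 + ln (lp_norm p x) / ?L z))"
    unfolding lp_power_index_def by (rule Limsup_mono)
  also have "\<dots> = 1" by (rule lim_imp_Limsup[OF _ lim]) simp
  finally show ?thesis .
qed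

section \<open>A vector of power index one\<close>

text \<open>
  The entries must decay fast enough for every \<open>p \<ge> 1\<close>, but only polynomially, so that weighting a
  series with them costs no more than a polynomial factor.
\<close>
definition quadratic_decay :: "nat \<Rightarrow> complex" where
  "quadratic_decay k = of_real (1 / (real k + 1)\<^sup>2)"

lemma quadratic_decay_in_lp: "quadratic_decay \<in> lp p"
proof -
  have "summable (\<lambda>k. 1 / (real k + 1)\<^sup>2)"
    using summable_Suc_iff[THEN iffD2, OF inverse_power_summable[of 2, where 'a=real]]
    by (simp add: inverse_eq_divide add_ac)
  then show ?thesis
    unfolding lp_def mem_Collect_eq
  proof (rule summable_comparison_test')
    fix k
    have norm: "cmod (quadratic_decay k) = 1 / (real k + 1)\<^sup>2"
      unfolding quadratic_decay_def norm_of_real by simp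
    have "(1 / (real k + 1)\<^sup>2) powr p \<le> (1 / (real k + 1)\<^sup>2) powr 1"
      using p by (intro powr_mono') auto
    then show "norm (cmod (quadratic_decay k) powr p) \<le> 1 / (real k + 1)\<^sup>2"
      by (simp add: norm)
  qed
qed

text \<open>
  Truncating at an index \<open>N\<close> after which consecutive terms of the majorant at least halve costs a
  factor \<open>2\<close>, and up to \<open>N\<close> the coefficients of the test vector cost at most \<open>(N + 1)\<^sup>2\<close>.
\<close>
lemma majorant_le_resolvent_quadratic_decay:
  assumes r: "0 < r" and N: "\<And>j. N < j \<Longrightarrow> 2 * r * w j \<le> 1"
  shows "resolvent_majorant w r
    \<le> 2 * (real N + 1)\<^sup>2 * lp_norm p (lp_resolvent p T (of_real (inverse r)) quadratic_decay)"
proof -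
  define a where "a k = weight_product w 0 k * r ^ (k + 1)" for k
  define b where "b k = a k / (real k + 1)\<^sup>2" for k
  have a0: "0 \<le> a k" for k
    using r less_imp_le[OF weight_product_pos[of 0 k]] by (simp add: a_def)
  have b0: "0 \<le> b k" for k using a0 by (simp add: b_def)
  have sa: "summable a" unfolding a_def using r by (intro majorant_summable) simp
  have ba: "b k \<le> a k" for k
    unfolding b_def using a0[of k] by (simp add: divide_le_eq mult_le_cancel_left1 add_nonneg_eq_0_iff)
  have sb: "summable b"
    by (rule summable_comparison_test'[OF sa]) (use ba b0 in auto)
  have tail: "a (N + k) \<le> a N * (1 / 2) ^ k" for k
  proof (induction k)
    case (Suc k)
    have "a (N + Suc k) = a (N + k) * (r * w (N + k + 1))"
      by (simp add: a_def weight_product_Suc mult_ac)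
    also have "\<dots> \<le> a (N + k) * (1 / 2)"
      using N[of "N + k + 1"] by (intro mult_left_mono a0) auto
    finally show ?case using Suc by simp
  qed simp
  have "(\<Sum>k. a (k + N)) \<le> (\<Sum>k. a N * (1 / 2) ^ k)"
    by (rule suminf_le) (use tail sa in \<open>auto simp: add.commute intro: summable_mult\<close>)
  also have "\<dots> = 2 * a N"
    by (subst suminf_mult) (auto simp: suminf_geometric)
  finally have "suminf a \<le> 2 * a N + (\<Sum>k<N. a k)"
    using suminf_split_initial_segment[OF sa, of N] by simp
  also have "\<dots> \<le> 2 * (\<Sum>k\<le>N. a k)"
    using sum_nonneg[of "{..<N}" a] a0 by (simp add: lessThan_Suc_atMost[symmetric])
  also have "\<dots> \<le> 2 * (\<Sum>k\<le>N. (real N + 1)\<^sup>2 * b k)"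
  proof (intro mult_left_mono sum_mono)
    fix k assume "k \<in> {..N}"
    then have "(real k + 1)\<^sup>2 * b k \<le> (real N + 1)\<^sup>2 * b k"
      by (intro mult_right_mono power_mono b0) auto
    moreover have "(real k + 1)\<^sup>2 * b k = a k" 
      by (simp add: b_def add_nonneg_eq_0_iff)
    ultimately show "a k \<le> (real N + 1)\<^sup>2 * b k" by simp
  qed simp
  also have "\<dots> = 2 * (real N + 1)\<^sup>2 * (\<Sum>k\<le>N. b k)"
    by (simp add: sum_distrib_left[symmetric])
  also have "\<dots> \<le> 2 * (real N + 1)\<^sup>2 * suminf b"
    by (intro mult_left_mono sum_le_suminf sb) (auto intro: b0)
  also have "suminf b
      \<le> lp_norm p (lp_resolvent p T (of_real (inverse r)) quadratic_decay)"
  proof -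
    let ?z = "complex_of_real (inverse r)"
    have z: "?z \<noteq> 0" using r by simp
    have "of_real (weight_product w 0 k) * quadratic_decay (0 + k) / ?z ^ (k + 1) = of_real (b k)" for k
      by (simp add: quadratic_decay_def b_def a_def field_simps)
    then have "neumann_series w ?z quadratic_decay 0 = of_real (suminf b)"
      unfolding neumann_series_def by (simp add: suminf_of_real[OF sb])
    then have "cmod (neumann_series w ?z quadratic_decay 0) = suminf b"
      using suminf_nonneg[OF sb b0] by simp
    then show ?thesis
      using norm_component_le_lp_norm[OF p neumann_series_in_lp[OF z quadratic_decay_in_lp], of 0]
        resolvent_eq_neumann_series[OF z quadratic_decay_in_lp] by simp
  qed
  finally show ?thesis
    by (simp add: resolvent_majorant_def a_def[abs_def] mult_left_mono)
qed

text \<open>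
  A decreasing \<open>q\<close>-summable sequence satisfies \<open>j * w j powr q \<le> const\<close>, so that only
  \<open>O(r powr q)\<close> weights exceed \<open>1 / (2 * r)\<close>.
\<close>
lemma large_weights_count:
  assumes q: "0 < q" and sum: "summable (\<lambda>n. w (n + 1) powr q)"
  obtains C where "0 < C"
    "\<And>r. 1 \<le> r \<Longrightarrow> \<exists>N. real N + 1 \<le> C * r powr q \<and> (\<forall>j>N. 2 * r * w j \<le> 1)"
proof
  define A where "A = (\<Sum>n. w (n + 1) powr q)"
  have A0: "0 \<le> A" unfolding A_def using sum by (intro suminf_nonneg) auto
  show "0 < A * 2 powr q + 2" using A0 by (simp add: add_nonneg_pos)
  have decay: "real j * w j powr q \<le> A" for j
  proof -
    have "real j * w j powr q = (\<Sum>n<j. w j powr q)" by simp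
    also have "\<dots> \<le> (\<Sum>n<j. w (n + 1) powr q)"
      using q by (intro sum_mono powr_mono2 w_antimono less_imp_le[OF w_pos]) auto
    also have "\<dots> \<le> A" unfolding A_def by (intro sum_le_suminf sum) auto
    finally show ?thesis .
  qed
  fix r :: real assume r: "1 \<le> r"
  \<comment> \<open>By \<open>decay\<close>, a weight exceeding \<open>1 / (2 * r)\<close> has index below \<open>A * (2 * r) powr q\<close>.\<close>
  define N where "N = nat \<lceil>A * (2 * r) powr q\<rceil>"
  have "real N \<le> A * (2 * r) powr q + 1"
    unfolding N_def using A0 by (simp add: of_nat_nat)
  moreover have "1 \<le> r powr q" using r q by (simp add: ge_one_powr_ge_zero)
  ultimately have "real N + 1 \<le> (A * 2 powr q + 2) * r powr q"
    using r by (simp add: powr_mult algebra_simps)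
  moreover have "2 * r * w j \<le> 1" if "N < j" for j
  proof (rule ccontr)
    assume "\<not> 2 * r * w j \<le> 1"
    then have "1 < (2 * r * w j) powr q" using q by (simp add: gr_one_powr)
    also have "\<dots> = (2 * r) powr q * w j powr q"
      using r less_imp_le[OF w_pos[of j]] that by (simp add: powr_mult)
    finally have "real j < (2 * r) powr q * (real j * w j powr q)"
      using that by (simp add: mult_ac)
    also have "\<dots> \<le> (2 * r) powr q * A" by (intro mult_left_mono decay) auto
    also have "\<dots> \<le> real N" unfolding N_def by (simp add: mult.commute) linarith
    finally show False using that by simp
  qed
  ultimately show "\<exists>N. real N + 1 \<le> (A * 2 powr q + 2) * r powr q \<and> (\<forall>j>N. 2 * r * w j \<le> 1)"
    by blast
qed

text \<open>
  Along \<open>z = 1 / r\<close> the quotient is bounded below by a function \<open>g\<close> tending to \<open>1\<close>: the bound on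
  the majorant loses a factor \<open>2 * C\<^sup>2 * r powr (2 * q)\<close>, whose logarithm is negligible.
\<close>
lemma power_index_quadratic_decay_ge_1:
  assumes q: "0 < q" and sum: "summable (\<lambda>n. w (n + 1) powr q)"
  shows "1 \<le> lp_power_index p T quadratic_decay"
proof (rule ccontr)
  let ?R = "\<lambda>z. lp_onorm p (lp_resolvent p T z)"
  let ?f = "\<lambda>z. ln (lp_norm p (lp_resolvent p T z quadratic_decay)) / ln (?R z)"
  let ?z = "\<lambda>r. complex_of_real (inverse r)"
  obtain C where C: "0 < C"
    "\<And>r. 1 \<le> r \<Longrightarrow> \<exists>N. real N + 1 \<le> C * r powr q \<and> (\<forall>j>N. 2 * r * w j \<le> 1)"
    using large_weights_count[OF q sum] by metis
  have "((\<lambda>r. inverse r :: real) \<longlongrightarrow> 0) at_top"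
    by (intro tendsto_inverse_0_at_top filterlim_ident)
  then have "(?z \<longlongrightarrow> of_real 0) at_top" by (rule tendsto_of_real)
  then have to0: "filterlim ?z (at 0) at_top"
    unfolding filterlim_at
    by (auto intro: eventually_mono[OF eventually_gt_at_top[of 0]])
  have L_top: "filterlim (\<lambda>r. ln (?R (?z r))) at_top at_top"
    by (rule filterlim_compose[OF ln_resolvent_onorm_at_top to0])
  define g where "g r = 1 - ln (2 * C\<^sup>2) / ln (?R (?z r)) - 2 * q * (ln r / ln (?R (?z r)))" for r
  have "(g \<longlongrightarrow> 1 - 0 - 2 * q * 0) at_top"
    unfolding g_def
    by (intro tendsto_diff tendsto_mult tendsto_const
        real_tendsto_divide_at_top[OF tendsto_const L_top] resolvent_onorm_superpolynomial)
  then have g_lim: "(g \<longlongrightarrow> 1) at_top" by simp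
  have g_le: "\<forall>\<^sub>F r in at_top. g r \<le> ?f (?z r)"
    using eventually_ge_at_top[of 1] L_top[unfolded filterlim_at_top_dense, rule_format, of 0]
  proof eventually_elim
    case (elim r)
    let ?G = "lp_norm p (lp_resolvent p T (?z r) quadratic_decay)"
    obtain N where N: "real N + 1 \<le> C * r powr q" "\<And>j. N < j \<Longrightarrow> 2 * r * w j \<le> 1"
      using C(2)[OF elim(1)] by blast
    have "?R (?z r) \<le> resolvent_majorant w r"
      using resolvent_onorm_le_majorant[of "?z r"] elim(1) by (simp add: norm_inverse)
    also have "\<dots> \<le> 2 * (real N + 1)\<^sup>2 * ?G"
      using elim(1) N(2) by (intro majorant_le_resolvent_quadratic_decay) auto
    also have "\<dots> \<le> 2 * (C * r powr q)\<^sup>2 * ?G"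
      using N(1) by (intro mult_right_mono mult_left_mono power_mono lp_norm_nonneg) auto
    finally have le: "?R (?z r) \<le> 2 * C\<^sup>2 * (r powr q)\<^sup>2 * ?G"
      by (simp add: power_mult_distrib)
    have R0: "0 < ?R (?z r)" using elim(1) by (intro resolvent_onorm_pos) simp
    have "?G \<noteq> 0" using le R0 by auto
    then have G0: "0 < ?G" using lp_norm_nonneg[of p] by (simp add: less_le)
    have "ln (?R (?z r)) \<le> ln (2 * C\<^sup>2 * (r powr q)\<^sup>2 * ?G)"
      using R0 le by (intro ln_mono) auto
    also have "\<dots> = ln (2 * C\<^sup>2) + 2 * q * ln r + ln ?G"
      using C(1) G0 elim(1) by (simp add: ln_mult ln_realpow)
    finally have "ln (?R (?z r)) - ln (2 * C\<^sup>2) - 2 * q * ln r \<le> ln ?G" by simp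
    then have "(ln (?R (?z r)) - ln (2 * C\<^sup>2) - 2 * q * ln r) / ln (?R (?z r)) \<le> ?f (?z r)"
      using elim(2) by (intro divide_right_mono) auto
    then show ?case
      unfolding g_def using elim(2) by (simp add: diff_divide_distrib)
  qed
  assume "\<not> 1 \<le> lp_power_index p T quadratic_decay"
  then obtain c where c: "lp_power_index p T quadratic_decay < ereal c" "ereal c < 1"
    using ereal_dense2[of "lp_power_index p T quadratic_decay" 1] by (auto simp: not_le)
  have "\<forall>\<^sub>F z in at 0. ereal (?f z) < ereal c"
    using c(1) unfolding lp_power_index_def by (rule Limsup_lessD)
  then have "\<forall>\<^sub>F r in at_top. ?f (?z r) < c"
    using eventually_compose_filterlim[OF _ to0] by fastforce
  moreover have "\<forall>\<^sub>F r in at_top. c < g r"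
    using g_lim c(2) by (intro order_tendstoD) (simp_all add: one_ereal_def)
  ultimately have "\<forall>\<^sub>F r::real in at_top. False"
    using g_le by eventually_elim simp
  then show False by simp
qed

end

theorem theorem3p1:
  fixes p p' :: real
    and w :: "nat \<Rightarrow> real"
    and T :: "(nat \<Rightarrow> complex) \<Rightarrow> nat \<Rightarrow> complex"
  assumes "1 \<le> p"
    and "backward_weighted_shift p (\<lambda>n. complex_of_real (w n)) T"
    and "\<And>n. 1 \<le> n \<Longrightarrow> 0 < w n"
    and "\<And>n. 1 \<le> n \<Longrightarrow> w (n + 1) \<le> w n"
    and "0 < p'"
    and "summable (\<lambda>n. w (n + 1) powr p')"
  shows "1 \<in> lp_power_set p T"
proof -
  have "(\<lambda>n. w (n + 1)) \<longlonglongrightarrow> 0"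
  proof -
    have "(\<lambda>n. (w (n + 1) powr p') powr (1 / p')) \<longlonglongrightarrow> 0 powr (1 / p')"
      using summable_LIMSEQ_zero[OF assms(6)] assms(5) by (intro tendsto_powr2) auto
    moreover have "(w (n + 1) powr p') powr (1 / p') = w (n + 1)" for n
      using assms(5) less_imp_le[OF assms(3)[of "n + 1"]] by (simp add: powr_powr)
    ultimately show ?thesis by simp
  qed
  then have "w \<longlonglongrightarrow> 0" by (rule LIMSEQ_offset)
  then interpret decreasing_backward_shift p w T
    using assms by unfold_locales auto
  have nz: "quadratic_decay \<noteq> (\<lambda>_. 0)"
    by (auto simp: quadratic_decay_def fun_eq_iff intro!: exI[of _ 0])
  have "lp_power_index p T quadratic_decay = 1"
    using power_index_le_1[OF quadratic_decay_in_lp nz]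
      power_index_quadratic_decay_ge_1[OF assms(5,6)] by (rule antisym)
  then show ?thesis
    unfolding lp_power_set_def using quasinilpotent quadratic_decay_in_lp nz by force
qed

end
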